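(* Let $a\geq 4$ be an integer, let $\rho'$ be the root of $x^3-ax^2-(a+3)x-1$ with $-2<\rho'<-1$, and put $A_0=\lfloor a/2\rfloor$. Then the homogeneous Jacobi--Perron expansion of the vector $(1,-\rho',\rho'^2)$ is periodic. The preperiod is equal to \begin{align*} \boldsymbol{\beta}^{(0)}&=(1,-\rho',\rho'^2),\\ \boldsymbol{\beta}^{(1)}&=(-1-\rho',-1+\rho'^2,1). \end{align*} The period length is $7$. The iterations (2)--(4) are equal to \begin{align*} \boldsymbol{\beta}^{(2)}&=(1+2\rho'+\rho'^2,\ a+2+(a+1)\rho',\ -1-\rho'),\\ \boldsymbol{\beta}^{(3)}&=(a+1+(a-1)\rho'-\rho'^2,\ -(a+2)-(2a+3)\rho'-(a+1)\rho'^2,\ 1+2\rho'+\rho'^2),\\ \boldsymbol{\beta}^{(4)}&=(-(a+2)-(2a+3)\rho'-(a+1)\rho'^2,\ -a-(a-3)\rho'+2\rho'^2,\ a+1+(a-1)\rho'-\rho'^2). \end{align*} If $a$ is even, the iterations (5)--(7) are \begin{align*} \boldsymbol{\beta}^{(5)}&=(-a-(a-3)\rho'+2\rho'^2,\ 2A_0^2+4A_0+1+(4A_0^2+5A_0-1)\rho'+(2A_0^2+A_0-1)\rho'^2,\\&\qquad -(a+2)-(2a+3)\rho'-(a+1)\rho'^2),\\ \boldsymbol{\beta}^{(6)}&=(2A_0^2+4A_0+1+(4A_0^2+5A_0-1)\rho'+(2A_0^2+A_0-1)\rho'^2,\ a-2-9\rho'-(a+5)\rho'^2,\\&\qquad -a-(a-3)\rho'+2\rho'^2),\\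 \boldsymbol{\beta}^{(7)}&=(a-2-9\rho'-(a+5)\rho'^2,\ -2A_0^2-6A_0-1-(4A_0^2+7A_0-4)\rho'-(2A_0^2+A_0-3)\rho'^2,\\&\qquad 2A_0^2+4A_0+1+(4A_0^2+5A_0-1)\rho'+(2A_0^2+A_0-1)\rho'^2). \end{align*} If $a$ is odd, the iterations (5)--(7) are \begin{align*} \boldsymbol{\beta}^{(5)}&=(-a-(a-3)\rho'+2\rho'^2,\ 2A_0^2+5A_0+2+(4A_0^2+7A_0)\rho'+(2A_0^2+2A_0-1)\rho'^2,\\&\qquad -(a+2)-(2a+3)\rho'-(a+1)\rho'^2),\\ \boldsymbol{\beta}^{(6)}&=(2A_0^2+7A_0+3+(4A_0^2+9A_0-2)\rho'+(2A_0^2+2A_0-3)\rho'^2,\ a-2-9\rho'-(a+5)\rho'^2,\\&\qquad -a-(a-3)\rho'+2\rho'^2),\\ \boldsymbol{\beta}^{(7)}&=(a-2-9\rho'-(a+5)\rho'^2,\ -2A_0^2-9A_0-4-(4A_0^2+11A_0-4)\rho'-(2A_0^2+2A_0-5)\rho'^2,\\&\qquad 2A_0^2+7A_0+3+(4A_0^2+9A_0-2)\rho'+(2A_0^2+2A_0-3)\rho'^2). \end{align*} Finally, the iteration (8) is $$\boldsymbol{\beta}^{(8)}=(-a^2-5-(a^2-a+14)\rho'-7\rho'^2,\ 7+(a^2+7a+26)\rho'+(a^2+6a+14)\rho'^2,\ a-2-9\rho'-(a+5)\rho'^2).$$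
   Context: The (homogeneous) Jacobi--Perron expansion of $\boldsymbol{\beta}^{(0)}=(\beta_1^{(0)},\beta_2^{(0)},\beta_3^{(0)})\in\mathbb{R}^3$ is the sequence $\boldsymbol{\beta}^{(k)}$, $k\ge 0$, with $$\boldsymbol{\beta}^{(k+1)}=\left(\beta_2^{(k)}-b_2^{(k)}\beta_1^{(k)},\ \beta_3^{(k)}-b_3^{(k)}\beta_1^{(k)},\ \beta_1^{(k)}\right),\qquad b_i^{(k)}=\left\lfloor \beta_i^{(k)}/\beta_1^{(k)}\right\rfloor .$$ It is periodic if there exist integers $l_0\ge 0$, $l_1\ge 1$ and a unit $\varepsilon$ (of the ring of integers of the number field generated by the entries) such that $\beta_i^{(k+l_1)}=\varepsilon\beta_i^{(k)}$ for all $1\le i\le 3$ and $k\ge l_0$. For the smallest such $l_0,l_1$, the vectors $\boldsymbol{\beta}^{(0)},\dots,\boldsymbol{\beta}^{(l_0-1)}$ form the preperiod and $\boldsymbol{\beta}^{(l_0)},\dots,\boldsymbol{\beta}^{(l_0+l_1-1)}$ the period; $l_0$ and $l_1$ are their lengths. *)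

theory Defs
  imports
    "HOL-Analysis.Analysis"
    "HOL-Algebra.Generated_Fields"
    "HOL-Algebra.Algebraic_Closure_Type"
begin

definition jp_step :: "real ^ 3 \<Rightarrow> real ^ 3" where
  "jp_step v = vector
     [v $ 2 - of_int \<lfloor>v $ 2 / v $ 1\<rfloor> * v $ 1,
      v $ 3 - of_int \<lfloor>v $ 3 / v $ 1\<rfloor> * v $ 1,
      v $ 1]"

definition jp_expansion :: "real ^ 3 \<Rightarrow> nat \<Rightarrow> real ^ 3" where
  "jp_expansion v k = (jp_step ^^ k) v"

text \<open>
  Division by zero is total in HOL, so \<open>jp_expansion\<close> also continues past a vanishing
  first entry. The following predicate says that this never happens, i.e.\ that every
  quotient in the recursion is a genuine one.
\<close>

definition jp_well_defined :: "real ^ 3 \<Rightarrow> bool" where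
  "jp_well_defined v \<longleftrightarrow> (\<forall>k. jp_expansion v k $ 1 \<noteq> 0)"

definition entry_field :: "real ^ 3 \<Rightarrow> real set" where
  "entry_field v = generate_field ring_of_type_algebra (range (($) v))"

definition ring_of_integers :: "real set \<Rightarrow> real set" where
  "ring_of_integers K = {x \<in> K. algebraic_int x}"

definition integer_units :: "real set \<Rightarrow> real set" where
  "integer_units K = {x \<in> ring_of_integers K. \<exists>y \<in> ring_of_integers K. x * y = 1}"

definition jp_periodic_with :: "real ^ 3 \<Rightarrow> nat \<Rightarrow> nat \<Rightarrow> bool" where
  "jp_periodic_with v l0 l1 \<longleftrightarrow> l1 \<ge> 1 \<and>
     (\<exists>\<epsilon> \<in> integer_units (entry_field v).
        \<forall>k\<ge>l0. \<forall>i. jp_expansion v (k + l1) $ i = \<epsilon> * jp_expansion v k $ i)"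

definition jp_periodic :: "real ^ 3 \<Rightarrow> bool" where
  "jp_periodic v \<longleftrightarrow> (\<exists>l0 l1. jp_periodic_with v l0 l1)"

text \<open>
  The two lengths are minimised independently of each other; by the lemma
  \<open>jp_periodic_with_lengths\<close> below the two minima are attained simultaneously.
\<close>

definition jp_preperiod_length :: "real ^ 3 \<Rightarrow> nat" where
  "jp_preperiod_length v = (LEAST l0. \<exists>l1. jp_periodic_with v l0 l1)"

definition jp_period_length :: "real ^ 3 \<Rightarrow> nat" where
  "jp_period_length v = (LEAST l1. \<exists>l0. jp_periodic_with v l0 l1)"

definition jp_preperiod :: "real ^ 3 \<Rightarrow> (real ^ 3) list" where
  "jp_preperiod v = map (jp_expansion v) [0..<jp_preperiod_length v]"

lemma jp_periodic_with_exchange: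
  assumes "jp_periodic_with v l0 l1" and "jp_periodic_with v m0 m1"
  shows "jp_periodic_with v m0 l1"
proof -
  from assms(1) obtain e where e: "l1 \<ge> 1" "e \<in> integer_units (entry_field v)"
    "\<And>k i. k \<ge> l0 \<Longrightarrow> jp_expansion v (k + l1) $ i = e * jp_expansion v k $ i"
    unfolding jp_periodic_with_def by blast
  from assms(2) obtain f where f: "m1 \<ge> 1" "f \<in> integer_units (entry_field v)"
    "\<And>k i. k \<ge> m0 \<Longrightarrow> jp_expansion v (k + m1) $ i = f * jp_expansion v k $ i"
    unfolding jp_periodic_with_def by blast
  have f0: "f \<noteq> 0" using f(2) by (auto simp: integer_units_def)
  have iter: "jp_expansion v (k + n * m1) $ i = f ^ n * jp_expansion v k $ i"
    if "k \<ge> m0" for k n i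
  proof (induction n)
    case (Suc n)
    have "jp_expansion v (k + n * m1 + m1) $ i = f * jp_expansion v (k + n * m1) $ i"
      using that by (intro f(3)) simp
    with Suc show ?case by (simp add: algebra_simps)
  qed simp
  have "jp_expansion v (k + l1) $ i = e * jp_expansion v k $ i" if "k \<ge> m0" for k i
  proof -
    have "l0 * 1 \<le> l0 * m1" using f(1) by (rule mult_le_mono2)
    hence "jp_expansion v (k + l0 * m1 + l1) $ i = e * jp_expansion v (k + l0 * m1) $ i"
      by (intro e(3)) linarith
    moreover have "k + l0 * m1 + l1 = (k + l1) + l0 * m1" by simp
    ultimately have "f ^ l0 * jp_expansion v (k + l1) $ i = e * (f ^ l0 * jp_expansion v k $ i)"
      using iter[of "k + l1"] iter[of k] that by (metis trans_le_add1)
    thus ?thesis using f0 by simp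
  qed
  with e show ?thesis unfolding jp_periodic_with_def by blast
qed

lemma jp_periodic_with_lengths:
  assumes "jp_periodic v"
  shows "jp_periodic_with v (jp_preperiod_length v) (jp_period_length v)"
proof -
  from assms obtain l0 l1 where l: "jp_periodic_with v l0 l1"
    unfolding jp_periodic_def by blast
  have "\<exists>m1. jp_periodic_with v (jp_preperiod_length v) m1"
    unfolding jp_preperiod_length_def by (rule LeastI_ex) (use l in blast)
  moreover have "\<exists>m0. jp_periodic_with v m0 (jp_period_length v)"
    unfolding jp_period_length_def by (rule LeastI_ex) (use l in blast)
  ultimately show ?thesis using jp_periodic_with_exchange by blast
qed

end

theory Submission
  imports Defs
begin

text \<open>
  With \<open>s = -1 - \<rho>\<close> the cubic becomes \<open>s\<^sup>3 + (a + 3) s\<^sup>2 + a s = 1\<close>. Up to a positive factor the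
  iterates \<open>3\<close> to \<open>8\<close> are short polynomial vectors in \<open>s\<close> and
  \<open>g = 1 - (a + 1) s - s\<^sup>2 = s\<^sup>2 / (1 + s)\<close>, so that all the floors follow from
  \<open>0 < g < s\<^sup>2\<close> and a cubic upper bound for \<open>s\<close>. Iterate \<open>9\<close> is \<open>g\<^sup>2\<close> times iterate \<open>2\<close>, and
  \<open>g\<close> is a unit. A period smaller than \<open>7\<close> would be coprime to \<open>7\<close> and would make iterate \<open>3\<close> a
  multiple of iterate \<open>2\<close>.
\<close>

section \<open>Scaling and floors in a single step\<close>

lemma scaleR_vector_3:
  "c *\<^sub>R (vector [x, y, z] :: real ^ 3) = vector [c * x, c * y, c * z]"
  by (simp add: vec_eq_iff forall_3)

lemma vector_3_eq_iff:
  "(vector [x, y, z] :: 'a::zero ^ 3) = vector [x', y', z'] \<longleftrightarrow> x = x' \<and> y = y' \<and> z = z'"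
  by (simp add: vec_eq_iff forall_3)

text \<open>The quotients under the floors do not change when numerator and denominator are both
  scaled, so iterates need only be tracked up to a factor.\<close>

lemma jp_step_scaleR:
  assumes "c \<noteq> 0"
  shows "jp_step (c *\<^sub>R v) = c *\<^sub>R jp_step v"
  using assms by (simp add: jp_step_def scaleR_vector_3 vector_3_eq_iff algebra_simps)

lemma jp_step_vector:
  fixes x y z :: real and p q :: int
  assumes "0 < x" "p * x \<le> y" "y < (p + 1) * x" "q * x \<le> z" "z < (q + 1) * x"
  shows "jp_step (vector [x, y, z]) = vector [y - p * x, z - q * x, x]"
proof -
  have "\<lfloor>y / x\<rfloor> = p" "\<lfloor>z / x\<rfloor> = q"
    using assms by (auto intro!: floor_unique simp: field_simps)
  then show ?thesis
    by (simp add: jp_step_def)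
qed

lemma jp_expansion_Suc: "jp_expansion v (Suc k) = jp_step (jp_expansion v k)"
  by (simp add: jp_expansion_def)

text \<open>Since the step commutes with scaling, a single proportional pair of iterates propagates
  to all later ones.\<close>

lemma jp_expansion_shift:
  assumes "c \<noteq> 0" "jp_expansion v (k0 + l) = c *\<^sub>R jp_expansion v k0" "k0 \<le> k"
  shows "jp_expansion v (k + l) = c *\<^sub>R jp_expansion v k"
  using assms(3)
proof (induction k rule: dec_induct)
  case base
  show ?case by (fact assms(2))
next
  case (step k)
  then show ?case
    by (simp add: jp_expansion_Suc jp_step_scaleR assms(1))
qed

text \<open>Multiples of a period are needed in \<open>period_length\<close>, where multiples of a
  supposed shorter period are compared with multiples of 7.\<close>

lemma jp_periodic_with_iter:
  assumes "jp_periodic_with v l0 l1"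
  obtains c where "\<And>k n. k \<ge> l0 \<Longrightarrow> jp_expansion v (k + n * l1) = c ^ n *\<^sub>R jp_expansion v k"
proof -
  obtain c where c: "\<And>k i. k \<ge> l0 \<Longrightarrow> jp_expansion v (k + l1) $ i = c * jp_expansion v k $ i"
    using assms unfolding jp_periodic_with_def by blast
  have "jp_expansion v (k + n * l1) = c ^ n *\<^sub>R jp_expansion v k" if "k \<ge> l0" for k n
  proof (induction n)
    case (Suc n)
    have "jp_expansion v (k + n * l1 + l1) = c *\<^sub>R jp_expansion v (k + n * l1)"
      using c[of "k + n * l1"] that by (simp add: vec_eq_iff)
    with Suc show ?case
      by (simp add: ac_simps)
  qed simp
  then show thesis by (rule that)
qed

section \<open>The field of the entries and algebraic integers\<close>

text \<open>The inverse of HOL-Algebra is a definite description and unspecified at zero, whence the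
  hypothesis in the last equation.\<close>

lemma ring_of_type_algebra_simps:
  "\<zero>\<^bsub>ring_of_type_algebra\<^esub> = (0 :: 'a :: field)"
  "\<one>\<^bsub>ring_of_type_algebra\<^esub> = (1 :: 'a)"
  "x \<oplus>\<^bsub>ring_of_type_algebra\<^esub> y = (x + y :: 'a)"
  "x \<otimes>\<^bsub>ring_of_type_algebra\<^esub> y = (x * y :: 'a)"
  "\<ominus>\<^bsub>ring_of_type_algebra\<^esub> x = (- x :: 'a)"
  "x \<noteq> 0 \<Longrightarrow> inv\<^bsub>ring_of_type_algebra\<^esub> x = (inverse x :: 'a)"
proof -
  let ?R = "ring_of_type_algebra :: 'a ring"
  interpret R: field ?R by (rule field_from_type_algebra)
  show "\<zero>\<^bsub>?R\<^esub> = 0" "\<one>\<^bsub>?R\<^esub> = 1" "x \<oplus>\<^bsub>?R\<^esub> y = x + y" "x \<otimes>\<^bsub>?R\<^esub> y = x * y"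
    by (simp_all add: ring_of_type_algebra_def)
  show "\<ominus>\<^bsub>?R\<^esub> x = - x"
    by (rule R.minus_equality) (simp_all add: ring_of_type_algebra_def)
  show "inv\<^bsub>?R\<^esub> x = inverse x" if "x \<noteq> 0"
    by (rule R.inv_unique'[symmetric]) (use that in \<open>simp_all add: ring_of_type_algebra_def\<close>)
qed

lemma entry_field_closed:
  "1 \<in> entry_field v"
  "v $ i \<in> entry_field v"
  "x \<in> entry_field v \<Longrightarrow> - x \<in> entry_field v"
  "x \<in> entry_field v \<Longrightarrow> inverse x \<in> entry_field v"
  "x \<in> entry_field v \<Longrightarrow> y \<in> entry_field v \<Longrightarrow> x + y \<in> entry_field v"
  "x \<in> entry_field v \<Longrightarrow> y \<in> entry_field v \<Longrightarrow> x * y \<in> entry_field v"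
proof -
  let ?R = "ring_of_type_algebra :: real ring"
  note E = entry_field_def ring_of_type_algebra_simps[where 'a = real]
  show one: "1 \<in> entry_field v"
    using generate_field.one[of ?R] by (simp add: E)
  show "v $ i \<in> entry_field v"
    by (simp add: entry_field_def generate_field.incl)
  show uminus: "- x \<in> entry_field v" if "x \<in> entry_field v" for x
    using that generate_field.a_inv[of x ?R] by (simp add: E)
  show plus: "x + y \<in> entry_field v" if "x \<in> entry_field v" "y \<in> entry_field v" for x y
    using that generate_field.eng_add[of x ?R _ y] by (simp add: E)
  show "x * y \<in> entry_field v" if "x \<in> entry_field v" "y \<in> entry_field v" for x y
    using that generate_field.eng_mult[of x ?R _ y] by (simp add: E)
  show "inverse x \<in> entry_field v" if "x \<in> entry_field v" for x
  \<comment> \<open>Only nonzero elements can be inverted inside \<open>generate_field\<close>; at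
    zero the convention \<open>inverse 0 = 0\<close> returns \<open>x\<close> itself.\<close>
  proof (cases "x = 0")
    case False
    with that generate_field.m_inv[of x ?R] show ?thesis
      by (simp add: E)
  qed (use that in simp)
qed

lemma algebraic_int_cubic:
  fixes x :: real and p q r :: int
  assumes "x ^ 3 + p * x\<^sup>2 + q * x + r = 0"
  shows "algebraic_int x"
  unfolding algebraic_int_altdef_ipoly
  by (intro exI[of _ "[:r, q, p, 1:]"])
     (use assms in \<open>simp add: power2_eq_square power3_eq_cube algebra_simps map_poly_pCons\<close>)

text \<open>Separating odd and even powers of \<open>x\<close> in its cubic and squaring gives a cubic for \<open>x\<^sup>2\<close>, which
  avoids the closure of algebraic integers under multiplication.\<close>

lemma algebraic_int_power2_cubic:
  fixes x :: real and p q :: int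
  assumes x: "x ^ 3 + p * x\<^sup>2 + q * x + 1 = 0"
  shows "algebraic_int (x\<^sup>2)" "algebraic_int (inverse (x\<^sup>2))"
proof -
  (* HOL-Algebra shadows the Groebner basis method, hence the qualified name. *)
  have "x\<^sup>2 * (x\<^sup>2 + q)\<^sup>2 = (p * x\<^sup>2 + 1)\<^sup>2"
    using x by Groebner_Basis.algebra
  then have y: "(x\<^sup>2) ^ 3 + (2 * of_int q - (of_int p)\<^sup>2) * (x\<^sup>2)\<^sup>2 + ((of_int q)\<^sup>2 - 2 * of_int p) * x\<^sup>2 - 1 = 0"
    by Groebner_Basis.algebra
  then show "algebraic_int (x\<^sup>2)"
    by (intro algebraic_int_cubic[of _ "2 * q - p\<^sup>2" "q\<^sup>2 - 2 * p" "-1"]) simp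
  have "x \<noteq> 0" using x by auto
  then have z: "x\<^sup>2 * inverse (x\<^sup>2) = 1" by simp
  \<comment> \<open>The cubic of \<open>x\<^sup>2\<close> with its coefficients reversed and the
    sign changed; its constant term -1 keeps the result monic.\<close>
  have "inverse (x\<^sup>2) ^ 3 + (2 * of_int p - (of_int q)\<^sup>2) * (inverse (x\<^sup>2))\<^sup>2 + ((of_int p)\<^sup>2 - 2 * of_int q) * inverse (x\<^sup>2) - 1 = 0"
    using y z by Groebner_Basis.algebra
  then show "algebraic_int (inverse (x\<^sup>2))"
    by (intro algebraic_int_cubic[of _ "2 * p - q\<^sup>2" "p\<^sup>2 - 2 * q" "-1"]) simp
qed

text \<open>The parity \<open>e\<close> of \<open>a\<close> is kept as a parameter, so that even and odd \<open>a\<close> share one computation;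
  \<open>u\<close> is the first entry of iterate \<open>6\<close> divided by \<open>g\<close>.\<close>

locale shifted_cubic_root =
  fixes a A e :: int and s g u :: real
  assumes a: "a \<ge> 4" "a = 2 * A + e" "e = 0 \<or> e = 1"
    and s_pos: "0 < s"
    and cubic: "s ^ 3 + (of_int a + 3) * s\<^sup>2 + a * s = 1"
    and g_def: "g = 1 - (of_int a + 1) * s - s\<^sup>2"
    and u_def: "u = 1 - A * (s * (s + 2)) - e * s"
begin

section \<open>Relations and inequalities for \<open>s\<close>, \<open>g\<close> and
  \<open>u\<close>\<close>

text \<open>This is the cubic in the factored form \<open>g * (1 + s) = s\<^sup>2\<close>, arranged
  so that the product \<open>g * s\<close> can be eliminated.\<close>

lemma g_s: "g * s = s\<^sup>2 - g"
  using cubic unfolding g_def by Groebner_Basis.algebra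

lemma g_pos: "0 < g"
proof -
  have "g * (1 + s) > 0"
    using g_s s_pos by (simp add: algebra_simps)
  then show ?thesis
    using s_pos by (simp add: zero_less_mult_iff)
qed

lemma g_less: "g < s\<^sup>2"
  using g_s mult_pos_pos[OF g_pos s_pos] by linarith

lemma a_s: "a * s = 1 - s - s\<^sup>2 - g"
  unfolding g_def by (simp add: algebra_simps)

text \<open>Parity forces \<open>a \<ge> 4 + e\<close>, and the cubic is monotone in
  \<open>a\<close>. The bound is free of \<open>a\<close>, and its dependence on \<open>e\<close> is
  what \<open>u_less\<close> uses.\<close>

lemma cubic_bound: "s ^ 3 + (7 + of_int e) * s\<^sup>2 + (4 + of_int e) * s \<le> 1"
proof -
  have "a \<ge> 4 + e" using a by presburger
  then have "real_of_int (4 + e) \<le> of_int a" by linarith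
  then have "(4 + of_int e) * s \<le> a * s" "(7 + of_int e) * s\<^sup>2 \<le> (of_int a + 3) * s\<^sup>2"
    using s_pos by (intro mult_right_mono; simp)+
  with cubic show ?thesis by linarith
qed

lemma s_bound: "5 * s < 1"
proof -
  have "4 * s \<le> a * s" using a(1) s_pos by (intro mult_right_mono) auto
  then show ?thesis using a_s g_pos zero_less_power[OF s_pos, of 2] by linarith
qed

lemma s2_bound: "5 * s\<^sup>2 < s"
  using s_bound s_pos by (simp add: power2_eq_square)

lemma s2_pos: "0 < s\<^sup>2"
  using s_pos by simp

lemma s3_bounds: "0 < s ^ 3" "5 * s ^ 3 < s\<^sup>2"
  using s_bound s_pos by (simp_all add: power2_eq_square power3_eq_cube)

lemma s_sq: "s * (s + 2) = s\<^sup>2 + 2 * s"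
  by (simp add: power2_eq_square algebra_simps)

lemma double_A: "2 * real_of_int A = of_int a - of_int e"
  using a(2) by simp

text \<open>Doubling turns \<open>A\<close> into \<open>a - e\<close>, and \<open>a_s\<close> then
  removes \<open>a * s\<close>. Neither \<open>a\<close> nor \<open>A\<close> is left, so
  \<open>u\<close> can be bounded uniformly.\<close>

lemma two_u: "2 * u = s + s ^ 3 + (4 + of_int e) * s\<^sup>2 + g"
  using a_s g_s double_A unfolding u_def by Groebner_Basis.algebra

lemma u_bounds: "s + 4 * s\<^sup>2 < 2 * u" "2 * u < s + 7 * s\<^sup>2" "0 \<le> e * s" "e * s \<le> s"
proof -
  have "0 \<le> e * s\<^sup>2" "e * s\<^sup>2 \<le> s\<^sup>2"
    using a(3) by auto
  then show "s + 4 * s\<^sup>2 < 2 * u" "2 * u < s + 7 * s\<^sup>2"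
    using two_u s3_bounds g_pos g_less s2_pos unfolding distrib_right by linarith+
  show "0 \<le> e * s" "e * s \<le> s"
    using a(3) s_pos by auto
qed

lemma u_pos: "0 < u" and s2_less_u: "s\<^sup>2 < u" and s_less_u: "s < 2 * u"
  using u_bounds s_pos s2_pos by linarith+

text \<open>By \<open>two_u\<close> it suffices to bound \<open>2 * u - s\<close> by
  \<open>s\<close>. Multiplying by \<open>1 + s\<close> turns \<open>g\<close> into
  \<open>s\<^sup>2\<close>; what remains is \<open>s\<close> times a cubic controlled by
  \<open>cubic_bound\<close>, plus \<open>s\<^sup>2\<close>.\<close>

lemma u_less: "u < s"
proof -
  have "(s ^ 3 + (4 + of_int e) * s\<^sup>2 + g) * (1 + s)
      = s * (s ^ 3 + (5 + of_int e) * s\<^sup>2 + (4 + of_int e) * s) + s\<^sup>2"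
    using g_s by Groebner_Basis.algebra
  also have "\<dots> < s * 1 + s\<^sup>2"
  proof -
    have "s ^ 3 + (5 + of_int e) * s\<^sup>2 + (4 + of_int e) * s < 1"
      using cubic_bound s2_pos unfolding distrib_right by linarith
    then show ?thesis using s_pos by simp
  qed
  also have "\<dots> = s * (1 + s)"
    by (simp add: power2_eq_square algebra_simps)
  finally show ?thesis
    using two_u s_pos by simp
qed

text \<open>A division with remainder by \<open>s\<^sup>2\<close>: the quotient is
  \<open>A + 3 + e\<close>, the remainder \<open>s ^ 3\<close>. With the analogous
  \<open>s_minus_u_eq\<close> it yields both floors of \<open>step7\<close>.\<close>

lemma u_eq: "u = (of_int A + 3 + of_int e) * s\<^sup>2 + s ^ 3"
proof -
  have "2 * u = 2 * ((of_int A + 3 + of_int e) * s\<^sup>2 + s ^ 3)"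
    using a_s g_s double_A two_u by Groebner_Basis.algebra
  then show ?thesis by simp
qed

lemma s_minus_u_eq: "s - u = of_int (A - 2) * s\<^sup>2 + g * s"
proof -
  have "2 * (s - u) = 2 * (of_int (A - 2) * s\<^sup>2 + g * s)"
    unfolding of_int_diff of_int_numeral using a_s g_s double_A two_u by Groebner_Basis.algebra
  then show ?thesis by simp
qed

text \<open>The remainder \<open>1 - (a + 1) * s\<close> equals \<open>s\<^sup>2 + g\<close>, which
  is positive and below \<open>2 * s\<^sup>2 < s\<close>. Hence the floor of \<open>1 / s\<close> is
  \<open>a + 1\<close>.\<close>

lemma one_bounds: "(of_int a + 1) * s \<le> 1" "1 < (of_int a + 1 + 1) * s"
  using a_s g_pos g_less s2_bound zero_less_power[OF s_pos, of 2]
  by (simp_all add: algebra_simps)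

section \<open>The steps from the initial vector around one period\<close>

abbreviation "v0 \<equiv> vector [1, 1 + s, (1 + s)\<^sup>2] :: real ^ 3"
text \<open>The iterate at which the period starts and to which \<open>step8\<close> returns up to a
  factor.\<close>

abbreviation "w2 \<equiv> vector [s\<^sup>2, 1 - (of_int a + 1) * s, s] :: real ^ 3"

lemma step0: "jp_step v0 = vector [s, s * (s + 2), 1]"
proof -
  have "jp_step v0 = vector [(1 + s) - of_int 1 * 1, (1 + s)\<^sup>2 - of_int 1 * 1, 1]"
    by (rule jp_step_vector) (use s_pos s_bound s2_bound in \<open>simp_all add: power2_sum\<close>)
  then show ?thesis
    by (simp add: vector_3_eq_iff power2_eq_square algebra_simps)
qed

lemma step1: "jp_step (vector [s, s * (s + 2), 1]) = w2"
proof -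
  have "jp_step (vector [s, s * (s + 2), 1])
      = vector [s * (s + 2) - of_int 2 * s, 1 - of_int (a + 1) * s, s]"
    by (rule jp_step_vector)
       (use s_pos s_bound s2_bound one_bounds in \<open>simp_all add: s_sq\<close>)
  then show ?thesis
    by (simp add: vector_3_eq_iff power2_eq_square algebra_simps)
qed

text \<open>All three remainders are multiples of \<open>g\<close>, the third because
  \<open>s\<^sup>2 = g * (1 + s)\<close>; the factor is split off and carried along from
  here.\<close>

lemma step2: "jp_step w2 = g *\<^sub>R vector [1, s * (s + 2), 1 + s]"
proof -
  have *: "(of_int a + 1) * s\<^sup>2 \<le> s" "s < (of_int a + 1 + 1) * s\<^sup>2"
    using one_bounds s_pos by (simp_all add: power2_eq_square flip: mult.assoc)
  have "jp_step w2
      = vector [(1 - (of_int a + 1) * s) - of_int 1 * s\<^sup>2, s - of_int (a + 1) * s\<^sup>2, s\<^sup>2]"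
    by (rule jp_step_vector)
       (use s_pos g_pos g_less * g_def in \<open>simp_all\<close>)
  moreover have "1 - (of_int a + 1) * s - of_int 1 * s\<^sup>2 = g * 1"
    by (simp add: g_def)
  moreover have "s - of_int (a + 1) * s\<^sup>2 = g * (s * (s + 2))" "s\<^sup>2 = g * (1 + s)"
    unfolding of_int_add of_int_1 using g_s g_def by Groebner_Basis.algebra+
  ultimately show ?thesis
    unfolding scaleR_vector_3 by metis
qed

lemma step3: "jp_step (vector [1, s * (s + 2), 1 + s]) = vector [s * (s + 2), s, 1]"
proof -
  have "jp_step (vector [1, s * (s + 2), 1 + s])
      = vector [s * (s + 2) - of_int 0 * 1, (1 + s) - of_int 1 * 1, 1]"
    by (rule jp_step_vector) (use s_pos s_bound s2_bound in \<open>simp_all add: s_sq\<close>)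
  then show ?thesis by simp
qed

text \<open>The number \<open>u\<close> is made for this step: dividing 1 by
  \<open>s * (s + 2)\<close> gives quotient \<open>A\<close> and remainder
  \<open>u + e * s\<close>.\<close>

lemma step4: "jp_step (vector [s * (s + 2), s, 1]) = vector [s, u + e * s, s * (s + 2)]"
proof -
  have u': "1 = u + e * s + A * (s * (s + 2))"
    by (simp add: u_def)
  have "0 \<le> u + e * s" "u + e * s < s * (s + 2)"
    unfolding s_sq using u_bounds u_pos s2_bound by linarith+
  then have "jp_step (vector [s * (s + 2), s, 1])
      = vector [s - of_int 0 * (s * (s + 2)), 1 - of_int A * (s * (s + 2)), s * (s + 2)]"
    by (intro jp_step_vector)
       (use s_pos u' in \<open>simp_all add: distrib_right\<close>)
  then show ?thesis by (simp add: u_def)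
qed

text \<open>The first quotient is the parity \<open>e\<close> itself, because
  \<open>0 < u < s\<close>. Subtracting it brings even and odd \<open>a\<close> to the same
  form.\<close>

lemma step5: "jp_step (vector [s, u + e * s, s * (s + 2)]) = vector [u, s\<^sup>2, s]"
proof -
  have "jp_step (vector [s, u + e * s, s * (s + 2)])
      = vector [u + e * s - of_int e * s, s * (s + 2) - of_int 2 * s, s]"
    by (rule jp_step_vector)
       (use s_pos u_pos s2_bound u_less in \<open>simp_all add: s_sq distrib_right\<close>)
  then show ?thesis
    by (simp add: s_sq)
qed

lemma step6: "jp_step (vector [u, s\<^sup>2, s]) = vector [s\<^sup>2, s - u, u]"
proof -
  have "jp_step (vector [u, s\<^sup>2, s]) = vector [s\<^sup>2 - of_int 0 * u, s - of_int 1 * u, u]"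
    by (rule jp_step_vector) (use u_pos u_less s2_less_u s_less_u in simp_all)
  then show ?thesis by simp
qed

text \<open>The remainders \<open>g * s\<close> and \<open>s ^ 3\<close> and the divisor
  \<open>s\<^sup>2\<close> share the factor \<open>s\<close>.\<close>

lemma step7: "jp_step (vector [s\<^sup>2, s - u, u]) = s *\<^sub>R vector [g, s\<^sup>2, s]"
proof -
  have "g * s < s\<^sup>2" "0 \<le> g * s" "0 \<le> s ^ 3" "s ^ 3 < s\<^sup>2"
    using g_s g_pos g_less s2_pos s3_bounds by linarith+
  then have "of_int (A - 2) * s\<^sup>2 \<le> s - u" "s - u < (of_int (A - 2) + 1) * s\<^sup>2"
    unfolding s_minus_u_eq distrib_right by simp_all
  moreover have "of_int (A + 3 + e) * s\<^sup>2 \<le> u" "u < (of_int (A + 3 + e) + 1) * s\<^sup>2"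
    using \<open>0 \<le> s ^ 3\<close> \<open>s ^ 3 < s\<^sup>2\<close> by (simp_all add: u_eq distrib_right)
  ultimately have "jp_step (vector [s\<^sup>2, s - u, u])
      = vector [s - u - of_int (A - 2) * s\<^sup>2, u - of_int (A + 3 + e) * s\<^sup>2, s\<^sup>2]"
    by (intro jp_step_vector) (use s_pos in simp_all)
  moreover have "s - u - of_int (A - 2) * s\<^sup>2 = s * g" "u - (of_int A + 3 + of_int e) * s\<^sup>2 = s * s\<^sup>2"
    using s_minus_u_eq u_eq by (simp_all add: power3_eq_cube power2_eq_square)
  ultimately show ?thesis
    by (simp add: vector_3_eq_iff scaleR_vector_3 power2_eq_square)
qed

text \<open>From \<open>g = s\<^sup>2 / (1 + s)\<close> follows \<open>s / g = 1 / s + 1\<close>, so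
  the second quotient is one more than the floor of \<open>1 / s\<close> in
  \<open>one_bounds\<close>.\<close>

lemma step8: "jp_step (vector [g, s\<^sup>2, s]) = (g / s) *\<^sub>R w2"
proof -
  have *: "s - (of_int a + 2) * g = g / s * (1 - (of_int a + 1) * s)"
    using g_s s_pos by (simp add: field_simps power2_eq_square)
  have "0 \<le> g / s * (1 - (of_int a + 1) * s)"
    using one_bounds g_pos s_pos by simp
  moreover have "g / s * (1 - (of_int a + 1) * s) < g / s * s"
    using one_bounds g_pos s_pos by (intro mult_strict_left_mono) (simp_all add: algebra_simps)
  ultimately have **: "(of_int a + 2) * g \<le> s" "s < (of_int a + 2 + 1) * g"
    using * s_pos by (simp_all add: algebra_simps)
  have "g * s < g"
    using g_pos s_bound by simp
  then have "jp_step (vector [g, s\<^sup>2, s])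
      = vector [s\<^sup>2 - of_int 1 * g, s - of_int (a + 2) * g, g]"
    by (intro jp_step_vector) (use g_pos g_s g_less ** in simp_all)
  moreover have "s\<^sup>2 - g = g / s * s\<^sup>2"
    using g_s s_pos by (simp add: power2_eq_square)
  ultimately show ?thesis
    using * s_pos by (simp add: vector_3_eq_iff scaleR_vector_3)
qed

lemma expansion:
  "jp_expansion v0 0 = v0"
  "jp_expansion v0 1 = vector [s, s * (s + 2), 1]"
  "jp_expansion v0 2 = w2"
  "jp_expansion v0 3 = g *\<^sub>R vector [1, s * (s + 2), 1 + s]"
  "jp_expansion v0 4 = g *\<^sub>R vector [s * (s + 2), s, 1]"
  "jp_expansion v0 5 = g *\<^sub>R vector [s, u + e * s, s * (s + 2)]"
  "jp_expansion v0 6 = g *\<^sub>R vector [u, s\<^sup>2, s]"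
  "jp_expansion v0 7 = g *\<^sub>R vector [s\<^sup>2, s - u, u]"
  "jp_expansion v0 8 = (g * s) *\<^sub>R vector [g, s\<^sup>2, s]"
  "jp_expansion v0 9 = g\<^sup>2 *\<^sub>R w2"
proof -
  have nz: "g \<noteq> 0" "s \<noteq> 0" "g * s \<noteq> 0" using g_pos s_pos by auto
  have S: "jp_expansion v0 (numeral n) = jp_step (jp_expansion v0 (pred_numeral n))" for n
    by (simp add: numeral_eq_Suc jp_expansion_Suc)
  show 0: "jp_expansion v0 0 = v0" by (simp add: jp_expansion_def)
  show 1: "jp_expansion v0 1 = vector [s, s * (s + 2), 1]"
    using 0 step0 by (simp add: jp_expansion_Suc)
  show 2: "jp_expansion v0 2 = w2" using 1 step1 by (simp add: S)
  show 3: "jp_expansion v0 3 = g *\<^sub>R vector [1, s * (s + 2), 1 + s]"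
    using 2 step2 by (simp add: S)
  show 4: "jp_expansion v0 4 = g *\<^sub>R vector [s * (s + 2), s, 1]"
    using 3 step3 nz by (simp add: S jp_step_scaleR)
  show 5: "jp_expansion v0 5 = g *\<^sub>R vector [s, u + e * s, s * (s + 2)]"
    using 4 step4 nz by (simp add: S jp_step_scaleR)
  show 6: "jp_expansion v0 6 = g *\<^sub>R vector [u, s\<^sup>2, s]"
    using 5 step5 nz by (simp add: S jp_step_scaleR)
  show 7: "jp_expansion v0 7 = g *\<^sub>R vector [s\<^sup>2, s - u, u]"
    using 6 step6 nz by (simp add: S jp_step_scaleR)
  show 8: "jp_expansion v0 8 = (g * s) *\<^sub>R vector [g, s\<^sup>2, s]"
    using 7 step7 nz by (simp add: S jp_step_scaleR)
  have "jp_expansion v0 9 = jp_step (jp_expansion v0 8)"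
    by (simp add: S)
  moreover have "g * s * (g / s) = g\<^sup>2"
    using nz by (simp add: power2_eq_square)
  ultimately show "jp_expansion v0 9 = g\<^sup>2 *\<^sub>R w2"
    by (simp only: 8 jp_step_scaleR[OF nz(3)] step8 scaleR_scaleR)
qed

section \<open>Entries of the iterates in the basis \<open>1, s, s\<^sup>2\<close>\<close>

lemma g_times_s: "g * s = -1 + (of_int a + 1) * s + 2 * s\<^sup>2"
  using g_s unfolding g_def by simp

lemma g_times_s2: "g * s\<^sup>2 = 2 - (2 * of_int a + 1) * s - (of_int a + 5) * s\<^sup>2"
proof -
  have "g * s\<^sup>2 = (g * s) * s"
    by (simp add: power2_eq_square)
  also have "\<dots> = - s + (of_int a + 1) * s\<^sup>2 + 2 * s ^ 3"
    unfolding g_times_s by (simp add: power2_eq_square power3_eq_cube algebra_simps)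
  also have "\<dots> = 2 - (2 * of_int a + 1) * s - (of_int a + 5) * s\<^sup>2"
    using cubic by (simp add: algebra_simps)
  finally show ?thesis .
qed

lemma g_times_s3:
  "g * s ^ 3 = - (of_int a + 5) + ((of_int a)\<^sup>2 + 5 * of_int a + 2) * s
    + ((of_int a)\<^sup>2 + 6 * of_int a + 14) * s\<^sup>2"
proof -
  have "g * s ^ 3 = (g * s\<^sup>2) * s"
    by (simp add: power2_eq_square power3_eq_cube)
  also have "\<dots> = 2 * s - (2 * of_int a + 1) * s\<^sup>2 - (of_int a + 5) * s ^ 3"
    unfolding g_times_s2 by (simp add: power2_eq_square power3_eq_cube algebra_simps)
  also have "\<dots> = 2 * s - (2 * of_int a + 1) * s\<^sup>2
      - (of_int a + 5) * (1 - (of_int a + 3) * s\<^sup>2 - of_int a * s)"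
    using cubic by (simp add: eq_diff_eq add.commute)
  finally show ?thesis
    by (simp add: power2_eq_square algebra_simps)
qed

lemma g_times_sq: "g * (s * (s + 2)) = s - (of_int a + 1) * s\<^sup>2"
proof -
  have "g * (s * (s + 2)) = g * s\<^sup>2 + 2 * (g * s)"
    by (simp add: power2_eq_square algebra_simps)
  then show ?thesis
    unfolding g_times_s g_times_s2 by (simp add: algebra_simps)
qed

lemma g_times_u:
  "g * u = 1 - (of_int a + 1) * s - s\<^sup>2 - A * (s - (of_int a + 1) * s\<^sup>2)
    - e * (-1 + (of_int a + 1) * s + 2 * s\<^sup>2)"
proof -
  have "g * u = g - A * (g * (s * (s + 2))) - e * (g * s)"
    unfolding u_def by (simp add: algebra_simps)
  then show ?thesis
    unfolding g_times_sq g_times_s by (simp add: g_def)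
qed

text \<open>The left sides have the shape of the entries in \<open>expansion\<close>; rewriting with
  them leaves only products that \<open>quadratic_forms\<close> covers.\<close>

lemma products:
  "g * 1 = 1 - (of_int a + 1) * s - s\<^sup>2"
  "g * (1 + s) = s\<^sup>2"
  "g * (u + e * s) = g * u + e * (g * s)"
  "g * (s - u) = g * s - g * u"
  "g * s * g = g * s - (of_int a + 1) * (g * s\<^sup>2) - g * s ^ 3"
  "g * s * s\<^sup>2 = g * s ^ 3"
  "g * s * s = g * s\<^sup>2"
proof -
  have "g * s * g = g * s * (1 - (of_int a + 1) * s - s\<^sup>2)"
    unfolding g_def ..
  also have "\<dots> = g * s - (of_int a + 1) * (g * s\<^sup>2) - g * s ^ 3"
    by (simp add: power2_eq_square power3_eq_cube algebra_simps)
  finally show "g * s * g = g * s - (of_int a + 1) * (g * s\<^sup>2) - g * s ^ 3" .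
qed (use g_s in \<open>simp_all add: g_def power2_eq_square power3_eq_cube algebra_simps\<close>)

lemmas quadratic_forms = g_times_sq g_times_u g_times_s g_times_s2 g_times_s3

section \<open>Periodicity, positivity and the unit\<close>

lemma shift7: "k \<ge> 2 \<Longrightarrow> jp_expansion v0 (k + 7) = g\<^sup>2 *\<^sub>R jp_expansion v0 k"
  using jp_expansion_shift[of "g\<^sup>2" v0 2 7 k] expansion(3,10) g_pos by simp

text \<open>Iterates 0 to 8 are explicit; from 9 on, \<open>shift7\<close> lowers the index by 7 at
  the cost of the positive factor \<open>g\<^sup>2\<close>.\<close>

lemma first_entry_pos: "0 < jp_expansion v0 k $ 1"
proof (induction k rule: less_induct)
  case (less k)
  show ?case
  proof (cases "k < 9")
    case True
    then have "k \<in> {0, 1, 2, 3, 4, 5, 6, 7, 8}" by auto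
    then show ?thesis
      \<comment> \<open>The simplifier turns the index \<open>1\<close> into \<open>Suc 0\<close>,
        hence the simplified copy of \<open>expansion(2)\<close>.\<close>
      using s_pos g_pos u_pos by (auto simp: expansion expansion(2)[simplified])
  next
    case False
    then have "jp_expansion v0 k = g\<^sup>2 *\<^sub>R jp_expansion v0 (k - 7)"
      using shift7[of "k - 7"] by simp
    then show ?thesis
      using less[of "k - 7"] False g_pos by simp
  qed
qed

text \<open>The characteristic polynomial of multiplication by \<open>g\<close> on
  \<open>1, s, s\<^sup>2\<close>. Its constant term 1 makes \<open>g\<close> a unit; the explicit
  \<open>of_int\<close> coefficients fit \<open>algebraic_int_power2_cubic\<close>.\<close>

lemma g_cubic: "g ^ 3 + of_int 3 * g\<^sup>2 + of_int (- (a\<^sup>2 + 3 * a + 6)) * g + 1 = 0"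
proof -
  have s3: "s ^ 3 = 1 - (of_int a + 3) * s\<^sup>2 - of_int a * s"
    using cubic by simp
  have "g * s ^ 4 = (g * s ^ 3) * s"
    by (simp add: power3_eq_cube power4_eq_xxxx)
  also have "\<dots> = - (of_int a + 5) * s + ((of_int a)\<^sup>2 + 5 * of_int a + 2) * s\<^sup>2
      + ((of_int a)\<^sup>2 + 6 * of_int a + 14) * s ^ 3"
    unfolding g_times_s3 by (simp add: power2_eq_square power3_eq_cube algebra_simps)
  finally have s4: "g * s ^ 4 = \<dots>" .
  have g2: "g\<^sup>2 = g - (of_int a + 1) * (g * s) - g * s\<^sup>2"
  proof -
    have "g\<^sup>2 = g * (1 - (of_int a + 1) * s - s\<^sup>2)"
      unfolding power2_eq_square[of g] by (subst (2) g_def) (rule refl)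
    then show ?thesis
      by (simp add: algebra_simps)
  qed
  have "g ^ 3 = g * g\<^sup>2"
    by (simp add: power2_eq_square power3_eq_cube)
  also have "\<dots> = g * (g - (of_int a + 1) * (g * s) - g * s\<^sup>2)"
    by (simp only: g2)
  also have "\<dots> = g\<^sup>2 - (of_int a + 1) * (g * s * g) - (g * s * g) * s"
    by (simp add: power2_eq_square algebra_simps)
  also have "(g * s * g) * s = g * s\<^sup>2 - (of_int a + 1) * (g * s ^ 3) - g * s ^ 4"
    unfolding products(5) by (simp add: power2_eq_square power3_eq_cube power4_eq_xxxx algebra_simps)
  finally have g3: "g ^ 3 = g\<^sup>2 - (of_int a + 1) * (g * s * g)
    - (g * s\<^sup>2 - (of_int a + 1) * (g * s ^ 3) - g * s ^ 4)" .
  show ?thesis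
    unfolding g3 g2 products(5)
    unfolding s4 g_times_s g_times_s2 g_times_s3
    unfolding g_def s3
    by (simp add: power2_eq_square algebra_simps)
qed

lemma g_power2_unit: "g\<^sup>2 \<in> integer_units (entry_field v0)"
proof -
  have s: "s \<in> entry_field v0" and t: "1 + s \<in> entry_field v0"
  proof -
    show t: "1 + s \<in> entry_field v0"
      using entry_field_closed(2)[of v0 2] by simp
    show "s \<in> entry_field v0"
      using entry_field_closed(5)[OF t entry_field_closed(3)[OF entry_field_closed(1)]] by simp
  qed
  \<comment> \<open>This form uses only field operations on \<open>s\<close>, whereas
    \<open>g_def\<close> would also require the integer \<open>a\<close> to lie in the
    field.\<close>
  have "g = s * s * inverse (1 + s)"
    using g_s s_pos by (simp add: field_simps power2_eq_square)
  then have "g \<in> entry_field v0"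
    using s t by (simp add: entry_field_closed)
  then have "g\<^sup>2 \<in> entry_field v0" "inverse (g\<^sup>2) \<in> entry_field v0"
    by (simp_all add: entry_field_closed power2_eq_square del: inverse_mult_distrib)
  moreover have "g\<^sup>2 * inverse (g\<^sup>2) = 1"
    using g_pos by simp
  ultimately show ?thesis
    using algebraic_int_power2_cubic[OF g_cubic]
    unfolding integer_units_def ring_of_integers_def by blast
qed

lemma periodic_with_2_7: "jp_periodic_with v0 2 7"
  unfolding jp_periodic_with_def using g_power2_unit shift7 by (auto intro!: bexI[of _ "g\<^sup>2"])

section \<open>Minimality of the period and of the preperiod\<close>

text \<open>The ratio of second to first entry is \<open>s * (s + 2) < 1\<close> in iterate 3, but
  \<open>(s\<^sup>2 + g) / s\<^sup>2 > 1\<close> in iterate 2.\<close>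

lemma w3_not_multiple: "jp_expansion v0 3 \<noteq> c *\<^sub>R jp_expansion v0 2"
proof
  assume "jp_expansion v0 3 = c *\<^sub>R jp_expansion v0 2"
  then have "g * 1 = c * s\<^sup>2" and 2: "g * (s * (s + 2)) = c * (1 - (of_int a + 1) * s)"
    unfolding expansion scaleR_vector_3 vector_3_eq_iff by blast+
  then have 1: "g = c * s\<^sup>2" by simp
  have 3: "1 - (of_int a + 1) * s = s\<^sup>2 + g"
    by (simp add: g_def)
  from 1 have "c > 0" using g_pos s_pos by (simp add: zero_less_mult_iff)
  then have "c * s\<^sup>2 < c * (s\<^sup>2 + g)" using g_pos by simp
  moreover have "g * (s * (s + 2)) < g * 1"
    using s_bound s2_bound g_pos by (simp add: s_sq)
  ultimately show False using 1 2 unfolding 3 by linarith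
qed

lemma period_length: "jp_period_length v0 = 7"
  unfolding jp_period_length_def
proof (rule Least_equality)
  show "\<exists>l0. jp_periodic_with v0 l0 7" using periodic_with_2_7 by blast
next
  fix l assume "\<exists>l0. jp_periodic_with v0 l0 l"
  then have per: "jp_periodic_with v0 2 l"
    using jp_periodic_with_exchange periodic_with_2_7 by blast
  show "7 \<le> l"
  proof (rule ccontr)
    assume "\<not> 7 \<le> l"
    moreover have "l \<ge> 1" using per by (simp add: jp_periodic_with_def)
    ultimately have "l \<in> {1, 2, 3, 4, 5, 6}" by auto
    \<comment> \<open>Here \<open>n\<close> is an inverse of \<open>l\<close> modulo 7, so
      \<open>n\<close> periods of length \<open>l\<close> lead from iterate 2 to iterate 3 shifted
      by \<open>m\<close> periods of length 7.\<close>
    then have "\<exists>n m. n * l = 1 + m * 7"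
      by (elim insertE emptyE; simp) presburger+
    then obtain n m where "n * l = 1 + m * 7" by blast
    then have nm: "2 + n * l = 3 + m * 7" by simp
    obtain c where c: "\<And>k n. k \<ge> 2 \<Longrightarrow> jp_expansion v0 (k + n * l) = c ^ n *\<^sub>R jp_expansion v0 k"
      using jp_periodic_with_iter[OF per] by metis
    obtain d where d: "\<And>k n. k \<ge> 2 \<Longrightarrow> jp_expansion v0 (k + n * 7) = d ^ n *\<^sub>R jp_expansion v0 k"
      using jp_periodic_with_iter[OF periodic_with_2_7] by metis
    have "d ^ m *\<^sub>R jp_expansion v0 3 = c ^ n *\<^sub>R jp_expansion v0 2"
      using c[of 2 n] d[of 3 m] unfolding nm by simp
    \<comment> \<open>Nothing else is known about the factor \<open>d\<close>, but a zero power
      would annihilate an iterate whose first entry is positive.\<close>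
    moreover have "d ^ m \<noteq> 0"
    proof
      assume 0: "d ^ m = 0"
      have "jp_expansion v0 (2 + m * 7) = 0"
        unfolding d[OF order_refl] 0 by simp
      then show False
        using first_entry_pos[of "2 + m * 7"] by simp
    qed
    ultimately have "jp_expansion v0 3 = (c ^ n / d ^ m) *\<^sub>R jp_expansion v0 2"
      by (simp add: vec_eq_iff field_simps)
    then show False using w3_not_multiple by blast
  qed
qed

text \<open>A shorter preperiod would make iterate 8 a multiple of iterate 1. The first entries
  force the factor \<open>g\<^sup>2\<close>, and the second ones then give
  \<open>s\<^sup>2 = g * (s + 2)\<close>, against \<open>s\<^sup>2 = g * (s + 1)\<close>.\<close>

lemma preperiod_length: "jp_preperiod_length v0 = 2"
  unfolding jp_preperiod_length_def
proof (rule Least_equality)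
  show "\<exists>l1. jp_periodic_with v0 2 l1" using periodic_with_2_7 by blast
next
  fix l assume "\<exists>l1. jp_periodic_with v0 l l1"
  then have per: "jp_periodic_with v0 l 7"
    using jp_periodic_with_exchange periodic_with_2_7 by blast
  show "2 \<le> l"
  proof (rule ccontr)
    assume "\<not> 2 \<le> l"
    then have l: "l \<le> 1" by simp
    obtain c where "jp_expansion v0 8 = c *\<^sub>R jp_expansion v0 1"
    proof -
      obtain c where c: "\<And>k n. k \<ge> l \<Longrightarrow> jp_expansion v0 (k + n * 7) = c ^ n *\<^sub>R jp_expansion v0 k"
        using jp_periodic_with_iter[OF per] by metis
      show thesis
        by (rule that[of c]) (use c[of 1 1] l in simp)
    qed
    then have 1: "g * s * g = c * s" and 2: "g * s * s\<^sup>2 = c * (s * (s + 2))"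
      by (simp_all only: expansion scaleR_vector_3 vector_3_eq_iff)
    from 1 s_pos have "c = g * g" by simp
    with 2 s_pos g_pos have "s\<^sup>2 = g * (s + 2)" by simp
    with g_s g_pos show False by (simp add: algebra_simps)
  qed
qed

lemma preperiod: "jp_preperiod v0 = [v0, vector [s, s * (s + 2), 1]]"
  using expansion(1,2) by (simp add: jp_preperiod_def preperiod_length upt_rec)

end

section \<open>Translation back to \<open>\<rho>\<close>\<close>

theorem theorem6p3:
  fixes a A0 :: int and \<rho> :: real and v :: "real ^ 3" and \<beta> :: "nat \<Rightarrow> real ^ 3"
  assumes "a \<ge> 4"
    and "\<rho> ^ 3 - a * \<rho>\<^sup>2 - (a + 3) * \<rho> - 1 = 0" and "- 2 < \<rho>" and "\<rho> < - 1"
    and "A0 = \<lfloor>real_of_int a / 2\<rfloor>"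
    and "v = vector [1, - \<rho>, \<rho>\<^sup>2]"
    and "\<beta> = jp_expansion v"
  shows "jp_well_defined v \<and> jp_periodic v
    \<and> jp_preperiod v = [vector [1, - \<rho>, \<rho>\<^sup>2], vector [- 1 - \<rho>, - 1 + \<rho>\<^sup>2, 1]]
    \<and> jp_period_length v = 7
    \<and> \<beta> 2 = vector
        [1 + 2 * \<rho> + \<rho>\<^sup>2,
         a + 2 + (a + 1) * \<rho>,
         - 1 - \<rho>]
    \<and> \<beta> 3 = vector
        [a + 1 + (a - 1) * \<rho> - \<rho>\<^sup>2,
         - (a + 2) - (2 * a + 3) * \<rho> - (a + 1) * \<rho>\<^sup>2,
         1 + 2 * \<rho> + \<rho>\<^sup>2]
    \<and> \<beta> 4 = vector
        [- (a + 2) - (2 * a + 3) * \<rho> - (a + 1) * \<rho>\<^sup>2,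
         - a - (a - 3) * \<rho> + 2 * \<rho>\<^sup>2,
         a + 1 + (a - 1) * \<rho> - \<rho>\<^sup>2]
    \<and> (even a \<longrightarrow>
        \<beta> 5 = vector
          [- a - (a - 3) * \<rho> + 2 * \<rho>\<^sup>2,
           2 * A0\<^sup>2 + 4 * A0 + 1 + (4 * A0\<^sup>2 + 5 * A0 - 1) * \<rho> + (2 * A0\<^sup>2 + A0 - 1) * \<rho>\<^sup>2,
           - (a + 2) - (2 * a + 3) * \<rho> - (a + 1) * \<rho>\<^sup>2]
      \<and> \<beta> 6 = vector
          [2 * A0\<^sup>2 + 4 * A0 + 1 + (4 * A0\<^sup>2 + 5 * A0 - 1) * \<rho> + (2 * A0\<^sup>2 + A0 - 1) * \<rho>\<^sup>2,
           a - 2 - 9 * \<rho> - (a + 5) * \<rho>\<^sup>2,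
           - a - (a - 3) * \<rho> + 2 * \<rho>\<^sup>2]
      \<and> \<beta> 7 = vector
          [a - 2 - 9 * \<rho> - (a + 5) * \<rho>\<^sup>2,
           - 2 * A0\<^sup>2 - 6 * A0 - 1 - (4 * A0\<^sup>2 + 7 * A0 - 4) * \<rho> - (2 * A0\<^sup>2 + A0 - 3) * \<rho>\<^sup>2,
           2 * A0\<^sup>2 + 4 * A0 + 1 + (4 * A0\<^sup>2 + 5 * A0 - 1) * \<rho> + (2 * A0\<^sup>2 + A0 - 1) * \<rho>\<^sup>2])
    \<and> (odd a \<longrightarrow>
        \<beta> 5 = vector
          [- a - (a - 3) * \<rho> + 2 * \<rho>\<^sup>2,
           2 * A0\<^sup>2 + 5 * A0 + 2 + (4 * A0\<^sup>2 + 7 * A0) * \<rho> + (2 * A0\<^sup>2 + 2 * A0 - 1) * \<rho>\<^sup>2,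
           - (a + 2) - (2 * a + 3) * \<rho> - (a + 1) * \<rho>\<^sup>2]
      \<and> \<beta> 6 = vector
          [2 * A0\<^sup>2 + 7 * A0 + 3 + (4 * A0\<^sup>2 + 9 * A0 - 2) * \<rho> + (2 * A0\<^sup>2 + 2 * A0 - 3) * \<rho>\<^sup>2,
           a - 2 - 9 * \<rho> - (a + 5) * \<rho>\<^sup>2,
           - a - (a - 3) * \<rho> + 2 * \<rho>\<^sup>2]
      \<and> \<beta> 7 = vector
          [a - 2 - 9 * \<rho> - (a + 5) * \<rho>\<^sup>2,
           - 2 * A0\<^sup>2 - 9 * A0 - 4 - (4 * A0\<^sup>2 + 11 * A0 - 4) * \<rho> - (2 * A0\<^sup>2 + 2 * A0 - 5) * \<rho>\<^sup>2,
           2 * A0\<^sup>2 + 7 * A0 + 3 + (4 * A0\<^sup>2 + 9 * A0 - 2) * \<rho> + (2 * A0\<^sup>2 + 2 * A0 - 3) * \<rho>\<^sup>2])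
    \<and> \<beta> 8 = vector
        [- a\<^sup>2 - 5 - (a\<^sup>2 - a + 14) * \<rho> - 7 * \<rho>\<^sup>2,
         7 + (a\<^sup>2 + 7 * a + 26) * \<rho> + (a\<^sup>2 + 6 * a + 14) * \<rho>\<^sup>2,
         a - 2 - 9 * \<rho> - (a + 5) * \<rho>\<^sup>2]"
proof -
  define e where "e = a mod 2"
  define s where "s = - 1 - \<rho>"
  define g where "g = 1 - (of_int a + 1) * s - s\<^sup>2"
  define u where "u = 1 - A0 * (s * (s + 2)) - e * s"
  have "A0 = a div 2"
    using assms(5) floor_divide_of_int_eq[of a 2] by simp
  then have a: "a = 2 * A0 + e" "e = 0 \<or> e = 1"
    unfolding e_def by presburger+
  interpret shifted_cubic_root a A0 e s g u
  proof
    have "\<rho> = - 1 - s" by (simp add: s_def)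
    moreover have "\<rho> ^ 3 - of_int a * \<rho>\<^sup>2 - (of_int a + 3) * \<rho> - 1 = 0"
      using assms(2) by simp
    ultimately show "s ^ 3 + (of_int a + 3) * s\<^sup>2 + of_int a * s = 1"
      by Groebner_Basis.algebra
    show "0 < s" using assms(4) by (simp add: s_def)
  qed (fact assms(1) a g_def u_def)+
  have rho: "\<rho> = - 1 - s" by (simp add: s_def)
  have v: "vector [1, - \<rho>, \<rho>\<^sup>2] = (vector [1, 1 + s, (1 + s)\<^sup>2] :: real ^ 3)"
    by (simp add: rho vector_3_eq_iff power2_eq_square algebra_simps)
  have w1: "vector [- 1 - \<rho>, - 1 + \<rho>\<^sup>2, 1] = (vector [s, s * (s + 2), 1] :: real ^ 3)"
    by (simp add: rho vector_3_eq_iff power2_eq_square algebra_simps)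
  have aA: "real_of_int a = 2 * of_int A0 + of_int e" using double_A by simp
  note E = expansion scaleR_vector_3 vector_3_eq_iff
  have 2: "\<beta> 2 = vector
        [1 + 2 * \<rho> + \<rho>\<^sup>2,
         a + 2 + (a + 1) * \<rho>,
         - 1 - \<rho>]"
    unfolding assms(6,7) v E
    unfolding products
    unfolding quadratic_forms rho
    by (simp add: power2_eq_square algebra_simps)
  have 3: "\<beta> 3 = vector
        [a + 1 + (a - 1) * \<rho> - \<rho>\<^sup>2,
         - (a + 2) - (2 * a + 3) * \<rho> - (a + 1) * \<rho>\<^sup>2,
         1 + 2 * \<rho> + \<rho>\<^sup>2]"
    unfolding assms(6,7) v E
    unfolding products
    unfolding quadratic_forms rho
    by (simp add: power2_eq_square algebra_simps)
  have 4: "\<beta> 4 = vector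
        [- (a + 2) - (2 * a + 3) * \<rho> - (a + 1) * \<rho>\<^sup>2,
         - a - (a - 3) * \<rho> + 2 * \<rho>\<^sup>2,
         a + 1 + (a - 1) * \<rho> - \<rho>\<^sup>2]"
    unfolding assms(6,7) v E
    unfolding products
    unfolding quadratic_forms rho
    by (simp add: power2_eq_square algebra_simps)
  have even: "\<beta> 5 = vector
          [- a - (a - 3) * \<rho> + 2 * \<rho>\<^sup>2,
           2 * A0\<^sup>2 + 4 * A0 + 1 + (4 * A0\<^sup>2 + 5 * A0 - 1) * \<rho> + (2 * A0\<^sup>2 + A0 - 1) * \<rho>\<^sup>2,
           - (a + 2) - (2 * a + 3) * \<rho> - (a + 1) * \<rho>\<^sup>2]
      \<and> \<beta> 6 = vector
          [2 * A0\<^sup>2 + 4 * A0 + 1 + (4 * A0\<^sup>2 + 5 * A0 - 1) * \<rho> + (2 * A0\<^sup>2 + A0 - 1) * \<rho>\<^sup>2,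
           a - 2 - 9 * \<rho> - (a + 5) * \<rho>\<^sup>2,
           - a - (a - 3) * \<rho> + 2 * \<rho>\<^sup>2]
      \<and> \<beta> 7 = vector
          [a - 2 - 9 * \<rho> - (a + 5) * \<rho>\<^sup>2,
           - 2 * A0\<^sup>2 - 6 * A0 - 1 - (4 * A0\<^sup>2 + 7 * A0 - 4) * \<rho> - (2 * A0\<^sup>2 + A0 - 3) * \<rho>\<^sup>2,
           2 * A0\<^sup>2 + 4 * A0 + 1 + (4 * A0\<^sup>2 + 5 * A0 - 1) * \<rho> + (2 * A0\<^sup>2 + A0 - 1) * \<rho>\<^sup>2]"
    if "even a"
  proof -
    have e: "e = 0" using that by (auto simp: e_def)
    then show ?thesis
      unfolding assms(6,7) v E
      unfolding products
      unfolding quadratic_forms rho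
      \<comment> \<open>Pushing the coercions to the leaves exposes \<open>real_of_int a\<close>,
        which \<open>aA\<close> replaces by \<open>A0\<close> and the parity; both sides become
        polynomials in \<open>A0\<close> and \<open>s\<close>.\<close>
      unfolding of_int_add of_int_diff of_int_mult of_int_minus of_int_power of_int_numeral
        of_int_1 aA e of_int_0
      by (simp add: power2_eq_square algebra_simps)
  qed
  have odd: "\<beta> 5 = vector
          [- a - (a - 3) * \<rho> + 2 * \<rho>\<^sup>2,
           2 * A0\<^sup>2 + 5 * A0 + 2 + (4 * A0\<^sup>2 + 7 * A0) * \<rho> + (2 * A0\<^sup>2 + 2 * A0 - 1) * \<rho>\<^sup>2,
           - (a + 2) - (2 * a + 3) * \<rho> - (a + 1) * \<rho>\<^sup>2]
      \<and> \<beta> 6 = vector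
          [2 * A0\<^sup>2 + 7 * A0 + 3 + (4 * A0\<^sup>2 + 9 * A0 - 2) * \<rho> + (2 * A0\<^sup>2 + 2 * A0 - 3) * \<rho>\<^sup>2,
           a - 2 - 9 * \<rho> - (a + 5) * \<rho>\<^sup>2,
           - a - (a - 3) * \<rho> + 2 * \<rho>\<^sup>2]
      \<and> \<beta> 7 = vector
          [a - 2 - 9 * \<rho> - (a + 5) * \<rho>\<^sup>2,
           - 2 * A0\<^sup>2 - 9 * A0 - 4 - (4 * A0\<^sup>2 + 11 * A0 - 4) * \<rho> - (2 * A0\<^sup>2 + 2 * A0 - 5) * \<rho>\<^sup>2,
           2 * A0\<^sup>2 + 7 * A0 + 3 + (4 * A0\<^sup>2 + 9 * A0 - 2) * \<rho> + (2 * A0\<^sup>2 + 2 * A0 - 3) * \<rho>\<^sup>2]"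
    if "odd a"
  proof -
    have e: "e = 1" using that by (auto simp: e_def odd_iff_mod_2_eq_one)
    then show ?thesis
      unfolding assms(6,7) v E
      unfolding products
      unfolding quadratic_forms rho
      unfolding of_int_add of_int_diff of_int_mult of_int_minus of_int_power of_int_numeral
        of_int_1 aA e of_int_0
      by (simp add: power2_eq_square algebra_simps)
  qed
  have 8: "\<beta> 8 = vector
        [- a\<^sup>2 - 5 - (a\<^sup>2 - a + 14) * \<rho> - 7 * \<rho>\<^sup>2,
         7 + (a\<^sup>2 + 7 * a + 26) * \<rho> + (a\<^sup>2 + 6 * a + 14) * \<rho>\<^sup>2,
         a - 2 - 9 * \<rho> - (a + 5) * \<rho>\<^sup>2]"
    unfolding assms(6,7) v E
    \<comment> \<open>This comes before \<open>quadratic_forms\<close>, since rewriting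
      \<open>g * s\<close> first would destroy the pattern \<open>g * s * g\<close>.\<close>
    unfolding products
    unfolding quadratic_forms rho
    by (simp add: power2_eq_square algebra_simps)
  have "jp_well_defined v"
    using first_entry_pos unfolding assms(6) v jp_well_defined_def by (metis less_irrefl)
  moreover have "jp_periodic v"
    using periodic_with_2_7 unfolding assms(6) v jp_periodic_def by blast
  ultimately show ?thesis
    using preperiod period_length 2 3 4 even odd 8
    unfolding assms(6) v w1 by simp
qed

end
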